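(* Let $G$ be a locally compact rectifiable space. Then $G$ is a paracompact space.
   Context: All spaces are assumed to be Hausdorff. A topological space $G$ is a rectifiable space if there are a surjective homeomorphism $\varphi: G\times G\rightarrow G\times G$ and an element $e\in G$ such that $\pi_1\circ\varphi=\pi_1$ and $\varphi(x,x)=(x,e)$ for every $x\in G$, where $\pi_1: G\times G\rightarrow G$ is the projection to the first coordinate. A space $X$ is locally compact if each $x\in X$ has a neighborhood $U$ in $X$ whose closure in $X$ is compact. *)

theory Defs
  imports "HOL-Analysis.Analysis"
begin

(* Separation axioms are not part of the two definitions below; they are stated separately
   where needed.  The existence of e forces a rectifiable space to be nonempty, and
   homeomorphic_map includes surjectivity onto the topspace of the codomain. *)

definition rectifiable_space :: "'a topology \<Rightarrow> bool" where
  "rectifiable_space G \<longleftrightarrow>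
    (\<exists>\<phi> e. e \<in> topspace G \<and>
       homeomorphic_map (prod_topology G G) (prod_topology G G) \<phi> \<and>
       (\<forall>z \<in> topspace (prod_topology G G). fst (\<phi> z) = fst z) \<and>
       (\<forall>x \<in> topspace G. \<phi> (x, x) = (x, e)))"

definition paracompact_space :: "'a topology \<Rightarrow> bool" where
  "paracompact_space X \<longleftrightarrow>
    (\<forall>\<U>. (\<forall>U \<in> \<U>. openin X U) \<and> \<Union>\<U> = topspace X \<longrightarrow>
       (\<exists>\<V>. (\<forall>V \<in> \<V>. openin X V) \<and> \<Union>\<V> = topspace X \<and>
            (\<forall>V \<in> \<V>. \<exists>U \<in> \<U>. V \<subseteq> U) \<and> locally_finite_in X \<V>))"

end

theory Submission
  imports Defs
begin

text \<open>
  Let \<open>\<phi>\<close> be the rectification and \<open>W\<close> a neighbourhood of \<open>e\<close> inside a compact set \<open>C\<close>. The relation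
  \<open>R = \<phi>\<^sup>-\<^sup>1(G \<times> W)\<close> is an open neighbourhood of the diagonal, and it enlarges a compact set \<open>K\<close> only to
  a subset of the compact second projection of \<open>\<phi>\<^sup>-\<^sup>1(K \<times> C)\<close>. Such a relation alone gives
  paracompactness. It need not be symmetric, so the sets \<open>R\<^sup>*(x)\<close>, although clopen and
  \<open>\<sigma>\<close>-compact, need not partition the space. The classes of \<open>R\<^sup>* \<inter> (R\<^sup>*)\<^sup>-\<^sup>1\<close> do, and they are still
  clopen, because a set closed under \<open>R\<close> is open and so is its complement, which is closed under
  \<open>R\<^sup>-\<^sup>1\<close>. Hence the space is a topological sum of regular Lindelof spaces.
\<close>

text \<open>Regularity puts a closed set \<open>C x\<close> between a neighbourhood
  \<open>N x\<close> and a member \<open>U x\<close> of the cover. Countably many \<open>N x\<close>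
  cover \<open>E\<close>, and removing the earlier closed sets from each chosen member makes the
  refinement locally finite. The union is exactly \<open>E\<close>, so that refinements over
  disjoint pieces can be put together.\<close>

lemma regular_Lindelof_open_refinement:
  assumes reg: "regular_space X"
    and lin: "Lindelof_space (subtopology X E)"
    and E: "openin X E"
    and \<U>: "\<And>U. U \<in> \<U> \<Longrightarrow> openin X U" and cov: "E \<subseteq> \<Union>\<U>"
  obtains \<V> where "\<And>V. V \<in> \<V> \<Longrightarrow> openin X V" "\<Union>\<V> = E"
    "\<And>V. V \<in> \<V> \<Longrightarrow> \<exists>U\<in>\<U>. V \<subseteq> U"
    "\<And>x. x \<in> E \<Longrightarrow> \<exists>N. openin X N \<and> x \<in> N \<and> finite {V \<in> \<V>. V \<inter> N \<noteq> {}}"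
proof (cases "E = {}")
  case True
  then show ?thesis
    using that[of "{}"] by auto
next
  case False
  have "\<forall>x\<in>E. \<exists>N C U. U \<in> \<U> \<and> openin X N \<and> closedin X C \<and> x \<in> N \<and> N \<subseteq> C \<and> C \<subseteq> U"
  proof
    fix x assume "x \<in> E"
    then obtain U where "U \<in> \<U>" "x \<in> U"
      using cov by blast
    then show "\<exists>N C U. U \<in> \<U> \<and> openin X N \<and> closedin X C \<and> x \<in> N \<and> N \<subseteq> C \<and> C \<subseteq> U"
      using reg \<U> unfolding neighbourhood_base_of_closedin[symmetric] neighbourhood_base_of
      by meson
  qed
  then obtain N C U where N: "\<And>x. x \<in> E \<Longrightarrow> openin X (N x) \<and> x \<in> N x \<and> N x \<subseteq> C x"
    and C: "\<And>x. x \<in> E \<Longrightarrow> closedin X (C x) \<and> C x \<subseteq> U x"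
    and U: "\<And>x. x \<in> E \<Longrightarrow> U x \<in> \<U>"
    by metis
  have Esub: "E \<subseteq> topspace X"
    using E openin_subset by blast
  have "\<exists>\<N>. countable \<N> \<and> \<N> \<subseteq> N ` E \<and> E \<subseteq> \<Union>\<N>"
    using lin N unfolding Lindelof_space_subtopology_subset[OF Esub]
    by (metis (no_types, lifting) UN_iff imageE subsetI)
  then obtain D where D: "countable D" "D \<subseteq> E" "E \<subseteq> \<Union>(N ` D)"
    by (metis countable_subset_image)
  with False have "D \<noteq> {}"
    by blast
  \<comment> \<open>The enumeration may repeat points, so a finite \<open>D\<close> needs no
    separate treatment.\<close>
  then obtain d :: "nat \<Rightarrow> 'a" where d: "D = range d"
    using D(1) range_from_nat_into by metis
  have dE: "d i \<in> E" for i
    using D(2) unfolding d by auto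
  \<comment> \<open>Removing finitely many closed sets keeps \<open>V i\<close> open, and it keeps
    \<open>V i\<close> away from \<open>N (d j)\<close> for every \<open>j < i\<close>.\<close>
  define V where "V i = U (d i) \<inter> E - (\<Union>j<i. C (d j))" for i
  have V_open: "openin X (V i)" for i
    unfolding V_def using E C U \<U> dE by (intro openin_diff openin_Int closedin_Union) auto
  show ?thesis
  proof (rule that[of "range V"])
    show "\<Union>(range V) = E"
    proof
      show "E \<subseteq> \<Union>(range V)"
      proof
        fix x assume x: "x \<in> E"
        then have ex: "\<exists>i. x \<in> U (d i)"
          using D d N C dE by (metis UN_E imageE subsetD)
        \<comment> \<open>For \<open>j < i\<close> the point \<open>x\<close> misses
          \<open>U (d j)\<close> and hence the smaller set \<open>C (d j)\<close>, so it survives in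
          \<open>V i\<close>.\<close>
        define i where "i = (LEAST i. x \<in> U (d i))"
        have "x \<in> U (d i)" "\<And>j. j < i \<Longrightarrow> x \<notin> U (d j)"
          unfolding i_def using LeastI_ex[OF ex] not_less_Least by auto
        then have "x \<in> V i"
          using x C dE unfolding V_def by blast
        then show "x \<in> \<Union>(range V)"
          by blast
      qed
    qed (auto simp: V_def)
    show "\<exists>U\<in>\<U>. W \<subseteq> U" if "W \<in> range V" for W
      using that U dE unfolding V_def by blast
    show "\<exists>M. openin X M \<and> x \<in> M \<and> finite {W \<in> range V. W \<inter> M \<noteq> {}}" if x: "x \<in> E" for x
    proof -
      obtain j where j: "x \<in> N (d j)"
        using x D(3) unfolding d by auto
      have "i \<le> j" if ne: "V i \<inter> N (d j) \<noteq> {}" for i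
      proof (rule ccontr)
        assume "\<not> i \<le> j"
        then have "V i \<inter> C (d j) = {}"
          unfolding V_def by auto
        with ne N[OF dE] show False
          by blast
      qed
      then have "{W \<in> range V. W \<inter> N (d j) \<noteq> {}} \<subseteq> V ` {..j}"
        by auto
      then have "finite {W \<in> range V. W \<inter> N (d j) \<noteq> {}}"
        by (rule finite_subset) simp
      then show ?thesis
        using j N dE by blast
    qed
  qed (use V_open in auto)
qed

text \<open>Each piece is refined separately and the refinements are united. As the pieces are open
  and disjoint, a point has a neighbourhood inside its own piece, which only that piece's refinement
  can meet.\<close>

lemma paracompact_space_open_Lindelof_partition:
  assumes reg: "regular_space X"
    and P_open: "\<And>E. E \<in> P \<Longrightarrow> openin X E"
    and P_lin: "\<And>E. E \<in> P \<Longrightarrow> Lindelof_space (subtopology X E)"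
    and P_disj: "disjoint P" and P_cov: "\<Union>P = topspace X"
  shows "paracompact_space X"
  unfolding paracompact_space_def
proof (intro allI impI, elim conjE)
  fix \<U> assume \<U>: "\<forall>U\<in>\<U>. openin X U" and cov: "\<Union>\<U> = topspace X"
  have "\<forall>E\<in>P. \<exists>\<V>. (\<forall>V\<in>\<V>. openin X V \<and> (\<exists>U\<in>\<U>. V \<subseteq> U)) \<and> \<Union>\<V> = E \<and>
      (\<forall>x\<in>E. \<exists>N. openin X N \<and> x \<in> N \<and> finite {V \<in> \<V>. V \<inter> N \<noteq> {}})"
  proof
    fix E assume E: "E \<in> P"
    show "\<exists>\<V>. (\<forall>V\<in>\<V>. openin X V \<and> (\<exists>U\<in>\<U>. V \<subseteq> U)) \<and> \<Union>\<V> = E \<and>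
        (\<forall>x\<in>E. \<exists>N. openin X N \<and> x \<in> N \<and> finite {V \<in> \<V>. V \<inter> N \<noteq> {}})"
    proof (rule regular_Lindelof_open_refinement[OF reg P_lin[OF E] P_open[OF E], of \<U>])
      show "openin X U" if "U \<in> \<U>" for U
        using \<U> that by blast
      show "E \<subseteq> \<Union>\<U>"
        using E cov P_cov by blast
    next
      fix \<V> assume "\<And>V. V \<in> \<V> \<Longrightarrow> openin X V" "\<Union>\<V> = E" "\<And>V. V \<in> \<V> \<Longrightarrow> \<exists>U\<in>\<U>. V \<subseteq> U"
        "\<And>x. x \<in> E \<Longrightarrow> \<exists>N. openin X N \<and> x \<in> N \<and> finite {V \<in> \<V>. V \<inter> N \<noteq> {}}"
      then show ?thesis
        by (intro exI[of _ \<V>] conjI ballI)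
    qed
  qed
  from bchoice[OF this] obtain \<V> where choice:
    "\<forall>E\<in>P. (\<forall>V\<in>\<V> E. openin X V \<and> (\<exists>U\<in>\<U>. V \<subseteq> U)) \<and> \<Union>(\<V> E) = E \<and>
      (\<forall>x\<in>E. \<exists>N. openin X N \<and> x \<in> N \<and> finite {V \<in> \<V> E. V \<inter> N \<noteq> {}})"
    by (elim exE)
  then have \<V>: "openin X V \<and> (\<exists>U\<in>\<U>. V \<subseteq> U)" if "E \<in> P" "V \<in> \<V> E" for E V
    using that by simp
  have \<V>_Un: "\<Union>(\<V> E) = E" if "E \<in> P" for E
    using that choice by simp
  have \<V>_fin: "\<exists>N. openin X N \<and> x \<in> N \<and> finite {V \<in> \<V> E. V \<inter> N \<noteq> {}}"
    if "E \<in> P" "x \<in> E" for E x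
    using that choice by simp
  have Un: "\<Union>(\<Union>(\<V> ` P)) = topspace X"
  proof -
    have "\<Union>(\<Union>(\<V> ` P)) = (\<Union>E\<in>P. \<Union>(\<V> E))"
      by blast
    then show ?thesis
      using \<V>_Un P_cov by simp
  qed
  moreover have "locally_finite_in X (\<Union>(\<V> ` P))"
    unfolding locally_finite_in_def
  proof (intro conjI ballI)
    fix x assume "x \<in> topspace X"
    then obtain E where E: "E \<in> P" "x \<in> E"
      using P_cov by blast
    from \<V>_fin[OF this] obtain N where N: "openin X N" "x \<in> N" "finite {V \<in> \<V> E. V \<inter> N \<noteq> {}}"
      by blast
    have "{V \<in> \<Union>(\<V> ` P). V \<inter> (N \<inter> E) \<noteq> {}} \<subseteq> {V \<in> \<V> E. V \<inter> N \<noteq> {}}"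
    proof clarify
      fix V F assume VF: "F \<in> P" "V \<in> \<V> F" "V \<inter> (N \<inter> E) \<noteq> {}"
      then have "F \<inter> E \<noteq> {}"
        using \<V>_Un by blast
      then have "F = E"
        using P_disj VF E by (auto simp: disjoint_def)
      with VF show "V \<in> \<V> E \<and> V \<inter> N \<noteq> {}"
        by blast
    qed
    then show "\<exists>M. openin X M \<and> x \<in> M \<and> finite {V \<in> \<Union>(\<V> ` P). V \<inter> M \<noteq> {}}"
      using N E P_open by (intro exI[of _ "N \<inter> E"]) (auto intro: finite_subset)
  qed (simp add: Un)
  moreover have "\<forall>V\<in>\<Union>(\<V> ` P). openin X V" "\<forall>V\<in>\<Union>(\<V> ` P). \<exists>U\<in>\<U>. V \<subseteq> U"
    using \<V> by (metis UN_E)+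
  ultimately show "\<exists>\<V>. (\<forall>V\<in>\<V>. openin X V) \<and> \<Union>\<V> = topspace X \<and>
      (\<forall>V\<in>\<V>. \<exists>U\<in>\<U>. V \<subseteq> U) \<and> locally_finite_in X \<V>"
    by (intro exI[of _ "\<Union>(\<V> ` P)"] conjI)
qed

text \<open>A box \<open>U \<times> V\<close> inside \<open>R\<close> around \<open>(x, x)\<close>
  gives a neighbourhood \<open>V\<close> of \<open>x\<close> all of whose points are
  \<open>R\<close>-successors of \<open>x\<close>.\<close>

lemma openin_if_closed_under_open_reflexive_relation:
  assumes R: "openin (prod_topology X X) R" and refl: "\<And>x. x \<in> topspace X \<Longrightarrow> (x, x) \<in> R"
    and A: "A \<subseteq> topspace X" "R `` A \<subseteq> A"
  shows "openin X A"
proof (subst openin_subopen, intro ballI)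
  fix x assume x: "x \<in> A"
  then obtain U V where "openin X V" "x \<in> U" "x \<in> V" "U \<times> V \<subseteq> R"
    using R refl A unfolding openin_prod_topology_alt by (metis subsetD)
  moreover from this have "V \<subseteq> A"
    using A x by blast
  ultimately show "\<exists>T. openin X T \<and> x \<in> T \<and> T \<subseteq> A"
    by blast
qed

lemma openin_prod_topology_converse:
  assumes "openin (prod_topology X Y) R"
  shows "openin (prod_topology Y X) (R\<inverse>)"
  unfolding openin_prod_topology_alt
proof (intro allI impI)
  fix y x assume "(y, x) \<in> R\<inverse>"
  then have "(x, y) \<in> R"
    by simp
  then obtain U V where "openin X U" "openin Y V" "x \<in> U" "y \<in> V" "U \<times> V \<subseteq> R"
    using assms unfolding openin_prod_topology_alt by meson
  then show "\<exists>V U. openin Y V \<and> openin X U \<and> y \<in> V \<and> x \<in> U \<and> V \<times> U \<subseteq> R\<inverse>"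
    by (intro exI[of _ V] exI[of _ U]) auto
qed

lemma clopen_if_closed_under_open_reflexive_relation:
  assumes R: "openin (prod_topology X X) R" and refl: "\<And>x. x \<in> topspace X \<Longrightarrow> (x, x) \<in> R"
    and A: "A \<subseteq> topspace X" "R `` A \<subseteq> A"
  shows "openin X A \<and> closedin X A"
proof
  show "openin X A"
    by (rule openin_if_closed_under_open_reflexive_relation[OF assms])
  \<comment> \<open>This keeps predecessors inside the space, so that the complement of
    \<open>A\<close> is closed under the converse of \<open>R\<close>.\<close>
  have "R \<subseteq> topspace X \<times> topspace X"
    using openin_subset[OF R] by simp
  then have "R\<inverse> `` (topspace X - A) \<subseteq> topspace X - A"
    using A by blast
  then have "openin X (topspace X - A)"
    using openin_if_closed_under_open_reflexive_relation[OF openin_prod_topology_converse[OF R]] refl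
    by simp
  then show "closedin X A"
    using A by (simp add: closedin_def)
qed

text \<open>The space is partitioned into the classes of mutual reachability along \<open>R\<close>.
  By \<open>grow\<close>, everything reachable from a point lies in a countable union of compact
  sets, which makes its class Lindelof.\<close>

lemma paracompact_space_if_open_relation:
  assumes reg: "regular_space X"
    and R: "openin (prod_topology X X) R" and refl: "\<And>x. x \<in> topspace X \<Longrightarrow> (x, x) \<in> R"
    and grow: "\<And>K. compactin X K \<Longrightarrow> \<exists>L. compactin X L \<and> R `` K \<subseteq> L"
  shows "paracompact_space X"
proof -
  have Rsub: "R \<subseteq> topspace X \<times> topspace X"
    using openin_subset[OF R] by simp
  \<comment> \<open>The closure \<open>R\<^sup>*\<close> is reflexive on the whole type, so it is
    not itself a relation on the space; but no chain enters or leaves the space.\<close>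
  have star_top: "x \<in> topspace X \<longleftrightarrow> y \<in> topspace X" if "(x, y) \<in> R\<^sup>*" for x y
    using that by (induction rule: rtrancl_induct) (use Rsub in auto)
  obtain f where f: "\<And>K. compactin X K \<Longrightarrow> compactin X (f K) \<and> R `` K \<subseteq> f K"
    using grow by metis
  define E where "E x = R\<^sup>* `` {x} \<inter> (R\<^sup>*)\<inverse> `` {x}" for x
  have E_clopen: "openin X (E x) \<and> closedin X (E x)" if x: "x \<in> topspace X" for x
  proof -
    have "openin X (R\<^sup>* `` {x}) \<and> closedin X (R\<^sup>* `` {x})"
      by (rule clopen_if_closed_under_open_reflexive_relation[OF R refl])
        (use star_top x in \<open>auto intro: rtrancl_into_rtrancl\<close>)
    moreover have "openin X ((R\<^sup>*)\<inverse> `` {x}) \<and> closedin X ((R\<^sup>*)\<inverse> `` {x})"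
      by (rule clopen_if_closed_under_open_reflexive_relation[OF openin_prod_topology_converse[OF R]])
        (use star_top x refl in \<open>auto intro: converse_rtrancl_into_rtrancl\<close>)
    ultimately show ?thesis
      unfolding E_def by auto
  qed
  have E_lin: "Lindelof_space (subtopology X (E x))" if x: "x \<in> topspace X" for x
  proof -
    \<comment> \<open>\<open>K n\<close> is compact and contains all points reached from
      \<open>x\<close> by a chain of \<open>n\<close> steps.\<close>
    define K where "K n = (f ^^ n) {x}" for n
    have K: "compactin X (K n)" for n
      by (induction n) (use x f in \<open>auto simp: K_def\<close>)
    have "y \<in> (\<Union>n. K n)" if "(x, y) \<in> R\<^sup>*" for y
      using that
    proof (induction rule: rtrancl_induct)
      case base
      have "x \<in> K 0"
        by (simp add: K_def)
      then show ?case
        by blast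
    next
      case (step y z)
      then obtain n where "y \<in> K n"
        by blast
      with step f[OF K] have "z \<in> K (Suc n)"
        by (auto simp: K_def)
      then show ?case
        by blast
    qed
    then have "E x = \<Union>(range (\<lambda>n. K n \<inter> E x))"
      unfolding E_def by blast
    moreover have "Lindelof_space (subtopology X (\<Union>(range (\<lambda>n. K n \<inter> E x))))"
    proof (rule Lindelof_space_Union)
      \<comment> \<open>The class is closed, so cutting \<open>K n\<close> down to it preserves
        compactness.\<close>
      fix S assume "S \<in> range (\<lambda>n. K n \<inter> E x)"
      then have "compactin X S"
        using K E_clopen[OF x] compact_Int_closedin by blast
      then show "Lindelof_space (subtopology X S)"
        by (simp add: compact_imp_Lindelof_space compact_space_subtopology)
    qed simp
    ultimately show ?thesis
      by simp
  qed
  have E_top: "E x \<subseteq> topspace X" if "x \<in> topspace X" for x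
    using E_clopen[OF that] openin_subset by blast
  show ?thesis
  proof (rule paracompact_space_open_Lindelof_partition[OF reg, of "E ` topspace X"])
    show "\<Union>(E ` topspace X) = topspace X"
      using E_top by (auto simp: E_def)
    have "E x = E y" if "E x \<inter> E y \<noteq> {}" for x y
      using that unfolding E_def by (auto intro: rtrancl_trans)
    then show "disjoint (E ` topspace X)"
      by (auto simp: disjoint_def)
  qed (use E_clopen E_lin in auto)
qed

theorem corollary2p11:
  fixes G :: "'a topology"
  assumes "Hausdorff_space G"
    and "rectifiable_space G"
    and "locally_compact_space G"
  shows "paracompact_space G"
proof -
  obtain \<phi> e where e: "e \<in> topspace G"
    and \<phi>: "homeomorphic_map (prod_topology G G) (prod_topology G G) \<phi>"
    and fst_\<phi>: "\<And>z. z \<in> topspace (prod_topology G G) \<Longrightarrow> fst (\<phi> z) = fst z"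
    and diag: "\<And>x. x \<in> topspace G \<Longrightarrow> \<phi> (x, x) = (x, e)"
    using assms(2) unfolding rectifiable_space_def by blast
  obtain \<psi> where "homeomorphic_maps (prod_topology G G) (prod_topology G G) \<phi> \<psi>"
    using \<phi> homeomorphic_map_maps by blast
  then have \<phi>_cont: "continuous_map (prod_topology G G) (prod_topology G G) \<phi>"
    and \<psi>_cont: "continuous_map (prod_topology G G) (prod_topology G G) \<psi>"
    and \<psi>_\<phi>: "\<And>z. z \<in> topspace (prod_topology G G) \<Longrightarrow> \<psi> (\<phi> z) = z"
    by (auto simp: homeomorphic_maps_def)
  obtain W C where W: "openin G W" "compactin G C" "e \<in> W" "W \<subseteq> C"
    using assms(3) e unfolding locally_compact_space_def by blast
  define R where "R = {z \<in> topspace (prod_topology G G). \<phi> z \<in> topspace G \<times> W}"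
  show ?thesis
  proof (rule paracompact_space_if_open_relation)
    \<comment> \<open>The Hausdorff axiom enters here, together with local compactness.\<close>
    show "regular_space G"
      using assms locally_compact_Hausdorff_imp_regular_space by blast
    show "openin (prod_topology G G) R"
      unfolding R_def using W
      by (intro openin_continuous_map_preimage[OF \<phi>_cont]) (simp add: openin_prod_Times_iff)
    show "(x, x) \<in> R" if "x \<in> topspace G" for x
      using that diag W by (simp add: R_def)
    fix K assume K: "compactin G K"
    have "compactin G ((snd \<circ> \<psi>) ` (K \<times> C))"
      using K W \<psi>_cont continuous_map_snd
      by (intro image_compactin[of "prod_topology G G"] continuous_map_compose)
        (auto simp: compactin_Times)
    \<comment> \<open>Since \<open>\<phi>\<close> fixes first coordinates, it sends a pair of
      \<open>R\<close> starting in \<open>K\<close> into \<open>K \<times> W\<close>, and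
      \<open>\<psi>\<close> recovers its second coordinate.\<close>
    moreover have "R `` K \<subseteq> (snd \<circ> \<psi>) ` (K \<times> C)"
    proof clarify
      fix x y assume xy: "x \<in> K" "(x, y) \<in> R"
      then have "\<phi> (x, y) \<in> K \<times> C" "\<psi> (\<phi> (x, y)) = (x, y)"
        using fst_\<phi>[of "(x, y)"] \<psi>_\<phi>[of "(x, y)"] W by (auto simp: R_def mem_Times_iff)
      then show "y \<in> (snd \<circ> \<psi>) ` (K \<times> C)"
        by (metis comp_apply image_eqI snd_conv)
    qed
    ultimately show "\<exists>L. compactin G L \<and> R `` K \<subseteq> L"
      by blast
  qed
qed

end
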